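(* Let $p\in(1,\infty)$, let $q=p/(p-1)$ (so $1/p+1/q=1$), and let $\varphi,f_0\in\mathcal{L}_p(\mathbb{R}^d)\cap\mathcal{P}$. Then, for every $\nu>0$, there exists a sequence $(f_{m,\nu})_{m\in\mathbb{N}}$ with $f_{m,\nu}\in\mathrm{co}_m(\mathcal{P}_{\varphi,\nu})$ for each $m\in\mathbb{N}$, such that $$\|f_{m,\nu}-\varphi_\nu*f_0\|_p\le\begin{cases}3\,\nu^{d/q}\,\|\varphi\|_p\,C_p\,m^{-1/q}&\text{if }1<p<2,\\ 3\,\nu^{d/q}\,\|\varphi\|_p\,C_p\,m^{-1/2}&\text{if }2\le p<\infty,\end{cases}$$ where $C_p<\infty$ is the constant, depending only on $p$, of the convex approximation theorem recalled in the context.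
   Context: $\mathcal{P}$ is the set of all probability density functions on $\mathbb{R}^d$: Lebesgue-measurable $f:\mathbb{R}^d\to[0,\infty)$ with $\int_{\mathbb{R}^d} f(x)\,dx=1$. $\mathcal{L}_p=\mathcal{L}_p(\mathbb{R}^d)$ is the Lebesgue space with norm $\|\cdot\|_p$. For $\mathcal{A}\subset\mathcal{L}_p$, $\mathrm{co}_m(\mathcal{A})=\{\sum_{j=1}^m\pi_jq_j : q_j\in\mathcal{A},\ \pi_j\ge0,\ \sum_{j=1}^m\pi_j=1\}$, $\mathrm{co}(\mathcal{A})=\bigcup_{m\in\mathbb{N}}\mathrm{co}_m(\mathcal{A})$, and $\overline{\mathrm{co}(\mathcal{A})}^p$ is its closure in $\mathcal{L}_p$. For $\varphi\in\mathcal{P}$ and $\nu>0$, $\varphi_\nu(x)=\nu^d\varphi(\nu x)$ and $\mathcal{P}_{\varphi,\nu}=\{x\mapsto\varphi_\nu(x-\mu) : \mu\in\mathbb{R}^d\}$. Convolution: $(f*g)(x)=\int_{\mathbb{R}^d} f(y)g(x-y)\,dy$. Constant $C_p$: a fixed finite constant depending only on $p$ for which the following (known) convex approximation theorem holds. If $\mathcal{A}\subset\mathcal{L}_p$, $f\in\overline{\mathrm{co}(\mathcal{A})}^p$ and $B>0$ satisfies $\|g-f\|_p\le B$ for all $g\in\mathcal{A}$, then for each $\epsilon>0$ there is a sequence $(g_m)_m$ with $g_m\in\mathrm{co}_m(\mathcal{A})$ and $\|g_m-f\|_p\le(B+\epsilon)C_pm^{-1/q}$ if $1<p<2$, and $\|g_m-f\|_p\le(B+\epsilon)C_pm^{-1/2}$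 if $2\le p<\infty$, for every $m\in\mathbb{N}$. *)

theory Defs
  imports "HOL-Analysis.Analysis"
begin

text \<open>
  Elements of \<open>Lp p\<close> are functions, not classes modulo null sets. The Bochner integral of a
  non-integrable function is \<open>0\<close>, so \<open>Lp_norm p f\<close> is meaningful only for \<open>f \<in> Lp p\<close>;
  membership has to be stated separately wherever it is not evident.
\<close>

definition Lp :: "real \<Rightarrow> (real ^ 'd \<Rightarrow> real) set" where
  "Lp p = {f. f \<in> borel_measurable lebesgue \<and> integrable lebesgue (\<lambda>x. \<bar>f x\<bar> powr p)}"

definition Lp_norm :: "real \<Rightarrow> (real ^ 'd \<Rightarrow> real) \<Rightarrow> real" where
  "Lp_norm p f = (\<integral>x. \<bar>f x\<bar> powr p \<partial>lebesgue) powr (1 / p)"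

definition Lp_closure :: "real \<Rightarrow> (real ^ 'd \<Rightarrow> real) set \<Rightarrow> (real ^ 'd \<Rightarrow> real) set" where
  "Lp_closure p S = {f \<in> Lp p. \<forall>\<delta>>0. \<exists>g\<in>S. Lp_norm p (\<lambda>x. g x - f x) < \<delta>}"

definition densities :: "(real ^ 'd \<Rightarrow> real) set" where
  "densities = {f. f \<in> borel_measurable lebesgue \<and> (\<forall>x. 0 \<le> f x) \<and>
     integrable lebesgue f \<and> (\<integral>x. f x \<partial>lebesgue) = 1}"

definition co_m :: "nat \<Rightarrow> (real ^ 'd \<Rightarrow> real) set \<Rightarrow> (real ^ 'd \<Rightarrow> real) set" where
  "co_m m A = {(\<lambda>x. \<Sum>j=1..m. w j * h j x) | (w :: nat \<Rightarrow> real) h.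
     (\<forall>j\<in>{1..m}. h j \<in> A \<and> 0 \<le> w j) \<and> (\<Sum>j=1..m. w j) = 1}"

text \<open>The index \<open>0\<close> is harmless in the union: \<open>co_m 0 A\<close> is empty.\<close>

definition co :: "(real ^ 'd \<Rightarrow> real) set \<Rightarrow> (real ^ 'd \<Rightarrow> real) set" where
  "co A = (\<Union>m. co_m m A)"

definition dilate :: "(real ^ 'd \<Rightarrow> real) \<Rightarrow> real \<Rightarrow> real ^ 'd \<Rightarrow> real" where
  "dilate \<phi> \<nu> x = \<nu> ^ CARD('d) * \<phi> (\<nu> *\<^sub>R x)"

definition location_family :: "(real ^ 'd \<Rightarrow> real) \<Rightarrow> real \<Rightarrow> (real ^ 'd \<Rightarrow> real) set" where
  "location_family \<phi> \<nu> = {(\<lambda>x. dilate \<phi> \<nu> (x - \<mu>)) | \<mu>. True}"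

definition convolve :: "(real ^ 'd \<Rightarrow> real) \<Rightarrow> (real ^ 'd \<Rightarrow> real) \<Rightarrow> real ^ 'd \<Rightarrow> real" where
  "convolve f g x = (\<integral>y. f y * g (x - y) \<partial>lebesgue)"

text \<open>
  \<open>convex_approx_constant TYPE('d) p C\<close> says that the convex approximation theorem in \<open>Lp p\<close>
  over \<open>real ^ 'd\<close> holds with constant \<open>C\<close>. The type argument only fixes the dimension.
\<close>

definition convex_approx_constant :: "'d::finite itself \<Rightarrow> real \<Rightarrow> real \<Rightarrow> bool" where
  "convex_approx_constant _ p C \<longleftrightarrow>
     (\<forall>(A :: (real ^ 'd \<Rightarrow> real) set) f B.
        A \<subseteq> Lp p \<and> f \<in> Lp_closure p (co A) \<and> B > 0 \<and>
        (\<forall>g\<in>A. Lp_norm p (\<lambda>x. g x - f x) \<le> B) \<longrightarrow>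
        (\<forall>\<epsilon>>0. \<exists>g :: nat \<Rightarrow> real ^ 'd \<Rightarrow> real. \<forall>m\<ge>1.
           g m \<in> co_m m A \<and>
           Lp_norm p (\<lambda>x. g m x - f x) \<le>
             (if p < 2 then (B + \<epsilon>) * C * real m powr (- 1 / (p / (p - 1)))
              else (B + \<epsilon>) * C * real m powr (- 1 / 2))))"

end

theory Submission imports Defs "HOL-Probability.Probability_Measure" begin

text \<open>
  The estimate is the convex approximation theorem applied to the family of translates of the
  dilated kernel \<open>\<phi>\<^sub>\<nu>\<close>. All members have the same norm \<open>N = \<nu> powr (d / q) * Lp_norm p \<phi>\<close>, which is
  positive because \<open>\<phi>\<close> is a density, and by Jensen's inequality the convolution
  \<open>\<phi>\<^sub>\<nu> * f0\<close> has norm at most \<open>N\<close>. So every member has distance at most \<open>B = 2 * N\<close> from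
  the convolution, and taking \<open>\<epsilon> = N\<close> gives \<open>B + \<epsilon> = 3 * N\<close>, the factor in the claim.

  What needs a proof is that the convolution lies in the closed convex hull of the translates
  (\<open>mixture_in_Lp_closure_co\<close>). The convolution is the mixture of the translates of \<open>\<phi>\<^sub>\<nu>\<close> with
  mixing density \<open>f0\<close>, and it is approximated by averages of \<open>m\<close> translates as in the law of
  large numbers (\<open>averages_approximate_mixture\<close>). The kernel is first truncated at a high level,
  which changes all averages and the mixture by little in \<open>L\<^sup>p\<close>. For the truncated kernel \<open>g\<close>
  the centres are chosen one after the other such that each choice is at least as good as the
  mean over the mixing distribution; this makes the squared \<open>L\<^sup>2\<close> error of the average at most
  \<open>1 / m\<close> times the square integral of \<open>g\<close> (\<open>greedy_centres\<close>). The error is also bounded in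
  \<open>L\<^sup>1\<close> and uniformly, and these three bounds make it small in \<open>L\<^sup>p\<close> (\<open>powr_interpolation\<close>).
\<close>

section \<open>Convexity and interpolation inequalities for powers\<close>

text \<open>
  Power functions are known to be convex on the open half-line. To pass to the whole line, the
  end point \<open>0\<close> is added by \<open>(s * a) powr p \<le> s * a powr p\<close> for \<open>0 < s < 1\<close>, and the result is
  composed with the convex function \<open>\<bar>x\<bar>\<close>. Convexity on \<open>UNIV\<close> lets Jensen's inequality be
  applied to arbitrary integrable functions.
\<close>

lemma convex_on_abs_powr:
  fixes p :: real
  assumes "1 \<le> p"
  shows "convex_on UNIV (\<lambda>x::real. \<bar>x\<bar> powr p)"
proof (rule convex_onI)
  fix t x y :: real
  assume t: "0 < t" "t < 1"
  have scale: "(s * a) powr p \<le> s * a powr p" if "0 < s" "s < 1" "0 \<le> a" for s a :: real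
  proof -
    have "s powr p \<le> s powr 1"
      using that assms by (intro powr_mono') auto
    then show ?thesis
      using that by (simp add: powr_mult mult_right_mono)
  qed
  have nonneg: "((1 - t) * a + t * b) powr p \<le> (1 - t) * a powr p + t * b powr p"
    if "0 \<le> a" "0 \<le> b" for a b :: real
  proof (cases "a = 0 \<or> b = 0")
    case True
    then show ?thesis using scale[of "1 - t" a] scale[of t b] t that by auto
  next
    case False
    then show ?thesis
      using convex_onD[OF powr_convex[OF assms], of t a b] t that by simp
  qed
  have "\<bar>(1 - t) * x + t * y\<bar> powr p \<le> ((1 - t) * \<bar>x\<bar> + t * \<bar>y\<bar>) powr p"
    using t assms by (intro powr_mono2) (auto intro!: order_trans[OF abs_triangle_ineq] simp: abs_mult)
  also have "\<dots> \<le> (1 - t) * \<bar>x\<bar> powr p + t * \<bar>y\<bar> powr p"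
    by (rule nonneg) auto
  finally show "\<bar>(1 - t) *\<^sub>R x + t *\<^sub>R y\<bar> powr p \<le> (1 - t) * \<bar>x\<bar> powr p + t * \<bar>y\<bar> powr p"
    by simp
qed simp

lemma abs_average_powr_le:
  fixes p :: real and a :: "'i \<Rightarrow> real"
  assumes "1 \<le> p" "finite S" "S \<noteq> {}"
  shows "\<bar>(\<Sum>i\<in>S. a i) / card S\<bar> powr p \<le> (\<Sum>i\<in>S. \<bar>a i\<bar> powr p) / card S"
proof -
  have "\<bar>\<Sum>i\<in>S. (1 / card S) *\<^sub>R a i\<bar> powr p \<le> (\<Sum>i\<in>S. (1 / card S) * \<bar>a i\<bar> powr p)"
    using assms by (intro convex_on_sum[OF _ _ convex_on_abs_powr]) auto
  then show ?thesis by (simp add: sum_divide_distrib)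
qed

text \<open>
  This and the next bound replace Minkowski's inequality. The constant here is crude, because
  it is only used for terms that can be made arbitrarily small; the one in \<open>abs_diff_powr_le\<close>
  is sharp enough to give exactly the triangle inequality for two functions of equal norm.
\<close>

lemma abs_sum3_powr_le:
  fixes a b c p :: real
  assumes "1 \<le> p"
  shows "\<bar>a + b + c\<bar> powr p \<le> 3 powr p * (\<bar>a\<bar> powr p + \<bar>b\<bar> powr p + \<bar>c\<bar> powr p)"
proof -
  let ?s = "\<lambda>i::nat. if i = 0 then a else if i = 1 then b else c"
  have "\<bar>(a + b + c) / 3\<bar> powr p \<le> (\<bar>a\<bar> powr p + \<bar>b\<bar> powr p + \<bar>c\<bar> powr p) / 3"
    using abs_average_powr_le[OF assms, of "{0,1,2}" ?s] by (simp add: add.assoc)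
  also have "\<dots> \<le> \<bar>a\<bar> powr p + \<bar>b\<bar> powr p + \<bar>c\<bar> powr p" by simp
  finally show ?thesis by (simp add: abs_divide powr_divide field_simps)
qed

lemma abs_diff_powr_le:
  fixes a b p :: real
  assumes "1 \<le> p"
  shows "\<bar>a - b\<bar> powr p \<le> 2 powr (p - 1) * (\<bar>a\<bar> powr p + \<bar>b\<bar> powr p)"
proof -
  let ?s = "\<lambda>i::nat. if i = 0 then a else - b"
  have "\<bar>(a - b) / 2\<bar> powr p \<le> (\<bar>a\<bar> powr p + \<bar>b\<bar> powr p) / 2"
    using abs_average_powr_le[OF assms, of "{0,1}" ?s] by simp
  then show ?thesis by (simp add: abs_divide powr_divide powr_diff field_simps)
qed

text \<open>
  For bounded functions an \<open>L\<^sup>1\<close> bound together with a small \<open>L\<^sup>2\<close> norm makes the \<open>L\<^sup>p\<close> norm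
  small: values below the threshold \<open>\<delta>\<close> are charged to \<open>L\<^sup>1\<close> and the others to \<open>L\<^sup>2\<close>. The two
  summands in the second coefficient treat \<open>p < 2\<close>, where \<open>\<bar>t\<bar> powr (p - 2)\<close> is largest at
  \<open>\<bar>t\<bar> = \<delta>\<close>, and \<open>p \<ge> 2\<close>, where it is largest at \<open>\<bar>t\<bar> = K\<close>.
\<close>

lemma powr_interpolation:
  fixes t \<delta> K p :: real
  assumes "1 < p" "0 < \<delta>" "\<bar>t\<bar> \<le> K"
  shows "\<bar>t\<bar> powr p \<le> \<delta> powr (p - 1) * \<bar>t\<bar> + (\<delta> powr (p - 2) + K powr (p - 2)) * t\<^sup>2"
proof (cases "\<bar>t\<bar> \<le> \<delta>")
  case True
  have "\<bar>t\<bar> powr p = \<bar>t\<bar> powr (p - 1) * \<bar>t\<bar>"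
    by (cases "t = 0") (auto simp: powr_diff)
  also have "\<dots> \<le> \<delta> powr (p - 1) * \<bar>t\<bar>"
    using assms True by (intro mult_right_mono powr_mono2) auto
  finally show ?thesis by (simp add: add_increasing2)
next
  case False
  then have "t \<noteq> 0" using assms by auto
  then have "\<bar>t\<bar> powr p = \<bar>t\<bar> powr (p - 2) * t\<^sup>2"
    by (simp add: powr_diff)
  also have "\<bar>t\<bar> powr (p - 2) \<le> \<delta> powr (p - 2) + K powr (p - 2)"
  proof (cases "2 \<le> p")
    case True
    then have "\<bar>t\<bar> powr (p - 2) \<le> K powr (p - 2)"
      using assms by (intro powr_mono2) auto
    then show ?thesis by (simp add: add_increasing)
  next
    case 2: False
    then have "\<bar>t\<bar> powr (p - 2) \<le> \<delta> powr (p - 2)"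
      using assms False by (intro powr_mono2') auto
    then show ?thesis by (simp add: add_increasing2)
  qed
  finally show ?thesis
    using assms by (simp add: mult_right_mono add_increasing)
qed

section \<open>Affine substitution and truncation\<close>

lemma integrable_mult_bounded:
  fixes f g :: "'a \<Rightarrow> real"
  assumes f: "integrable M f" and g [measurable]: "g \<in> borel_measurable M" and b: "\<And>x. \<bar>g x\<bar> \<le> B"
  shows "integrable M (\<lambda>x. g x * f x)"
proof (rule Bochner_Integration.integrable_bound)
  show "integrable M (\<lambda>x. B * f x)" using f by simp
  show "(\<lambda>x. g x * f x) \<in> borel_measurable M" using f by measurable
  show "AE x in M. norm (g x * f x) \<le> norm (B * f x)"
    using b by (auto simp: abs_mult intro!: mult_right_mono order_trans[OF b abs_ge_self])
qed

lemma nn_integral_lborel_affine: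
  fixes f :: "'a::euclidean_space \<Rightarrow> ennreal"
  assumes [measurable]: "f \<in> borel_measurable borel" and "c \<noteq> 0"
  shows "(\<integral>\<^sup>+x. f x \<partial>lborel) = ennreal (\<bar>c\<bar> ^ DIM('a)) * (\<integral>\<^sup>+x. f (t + c *\<^sub>R x) \<partial>lborel)"
  by (subst lborel_affine[OF \<open>c \<noteq> 0\<close>, of t])
     (simp add: nn_integral_density nn_integral_distr nn_integral_cmult)

lemma integrable_lborel_affine:
  fixes f :: "'a::euclidean_space \<Rightarrow> real"
  assumes f: "integrable lborel f" and "c \<noteq> 0"
  shows "integrable lborel (\<lambda>x. f (t + c *\<^sub>R x))"
proof -
  have [measurable]: "f \<in> borel_measurable borel" using f by auto
  have "integrable (density (distr lborel borel (\<lambda>x. t + c *\<^sub>R x)) (\<lambda>_. \<bar>c\<bar> ^ DIM('a))) f"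
    using f lborel_affine[OF \<open>c \<noteq> 0\<close>, of t] by simp
  then show ?thesis
    using \<open>c \<noteq> 0\<close> by (simp add: integrable_density integrable_distr_eq)
qed

lemma integral_lborel_affine:
  fixes f :: "'a::euclidean_space \<Rightarrow> real"
  assumes [measurable]: "f \<in> borel_measurable borel" and "c \<noteq> 0"
  shows "(\<integral>x. f x \<partial>lborel) = \<bar>c\<bar> ^ DIM('a) * (\<integral>x. f (t + c *\<^sub>R x) \<partial>lborel)"
  by (subst lborel_affine[OF \<open>c \<noteq> 0\<close>, of t])
     (simp add: integral_density integral_distr)

lemma AE_lborel_affine:
  fixes P :: "'a::euclidean_space \<Rightarrow> bool"
  assumes "AE x in lborel. P x" and "c \<noteq> 0"
  shows "AE x in lborel. P (t + c *\<^sub>R x)"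
proof -
  have "AE x in density (distr lborel borel (\<lambda>x. t + c *\<^sub>R x)) (\<lambda>_. \<bar>c\<bar> ^ DIM('a)). P x"
    using assms(1) by (subst (asm) lborel_affine[OF \<open>c \<noteq> 0\<close>, of t])
  then have "AE x in distr lborel borel (\<lambda>x. t + c *\<^sub>R x). P x"
    using \<open>c \<noteq> 0\<close> by (subst (asm) AE_density) auto
  then show ?thesis by (rule AE_distrD[rotated]) simp
qed

corollary integrable_lborel_translate:
  fixes f :: "'a::euclidean_space \<Rightarrow> real"
  shows "integrable lborel f \<Longrightarrow> integrable lborel (\<lambda>x. f (x - y))"
  using integrable_lborel_affine[of f 1 "- y"] by simp

corollary integral_lborel_translate:
  fixes f :: "'a::euclidean_space \<Rightarrow> real"
  shows "f \<in> borel_measurable borel \<Longrightarrow> (\<integral>x. f (x - y) \<partial>lborel) = (\<integral>x. f x \<partial>lborel)"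
  using integral_lborel_affine[of f 1 "- y"] by simp

corollary nn_integral_lborel_translate:
  fixes f :: "'a::euclidean_space \<Rightarrow> ennreal"
  shows "f \<in> borel_measurable borel \<Longrightarrow> (\<integral>\<^sup>+x. f (x - y) \<partial>lborel) = (\<integral>\<^sup>+x. f x \<partial>lborel)"
  using nn_integral_lborel_affine[of f 1 "- y"] by simp

lemma truncation_Lp_tendsto_zero:
  fixes \<psi> :: "'a::euclidean_space \<Rightarrow> real"
  assumes "0 < p" and [measurable]: "\<psi> \<in> borel_measurable borel" and nonneg: "\<And>x. 0 \<le> \<psi> x"
    and \<psi>p: "integrable lborel (\<lambda>x. \<bar>\<psi> x\<bar> powr p)"
  shows "(\<lambda>n. \<integral>x. \<bar>\<psi> x - min (\<psi> x) (real n)\<bar> powr p \<partial>lborel) \<longlonglongrightarrow> 0"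
proof -
  have "(\<lambda>n. \<integral>x. \<bar>\<psi> x - min (\<psi> x) (real n)\<bar> powr p \<partial>lborel) \<longlonglongrightarrow> (\<integral>x. 0 \<partial>(lborel :: 'a measure))"
  proof (rule integral_dominated_convergence[OF _ _ \<psi>p])
    show "AE x in lborel. (\<lambda>n. \<bar>\<psi> x - min (\<psi> x) (real n)\<bar> powr p) \<longlonglongrightarrow> 0"
    proof (rule AE_I2)
      fix x
      have "eventually (\<lambda>n. \<bar>\<psi> x - min (\<psi> x) (real n)\<bar> powr p = 0) sequentially"
        using eventually_ge_at_top[of "nat \<lceil>\<psi> x\<rceil>"]
      proof eventually_elim
        case (elim n)
        then have "\<psi> x \<le> real n" by linarith
        then show ?case using \<open>0 < p\<close> by (simp add: min_absorb1)
      qed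
      then show "(\<lambda>n. \<bar>\<psi> x - min (\<psi> x) (real n)\<bar> powr p) \<longlonglongrightarrow> 0"
        by (rule tendsto_eventually)
    qed
    show "AE x in lborel. norm (\<bar>\<psi> x - min (\<psi> x) (real n)\<bar> powr p) \<le> \<bar>\<psi> x\<bar> powr p" for n
      using nonneg \<open>0 < p\<close> by (intro AE_I2) (auto intro!: powr_mono2 simp: min_def)
  qed simp_all
  then show ?thesis by simp
qed

section \<open>Location mixtures\<close>

text \<open>
  The mixing distribution is kept abstract, so that its density does not enter the arguments by
  Fubini's theorem and Jensen's inequality.
\<close>

locale location_mixture = prob_space P for P :: "'a::euclidean_space measure" +
  assumes sets_P [measurable_cong]: "sets P = sets borel"
begin

sublocale pair_sigma_finite lborel P ..

definition mix :: "('a \<Rightarrow> real) \<Rightarrow> 'a \<Rightarrow> real" where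
  "mix g x = (\<integral>y. g (x - y) \<partial>P)"

lemma measurable_mix [measurable]:
  assumes [measurable]: "g \<in> borel_measurable borel"
  shows "mix g \<in> borel_measurable borel"
  unfolding mix_def by measurable

text \<open>
  Every translate of \<open>g\<close> has the same \<open>L\<^sup>1\<close> norm and \<open>P\<close> has mass \<open>1\<close>. The joint integrability
  yields the following facts by Fubini's theorem.
\<close>

lemma integrable_translates:
  fixes g :: "'a \<Rightarrow> real"
  assumes g: "integrable lborel g"
  shows "integrable (lborel \<Otimes>\<^sub>M P) (\<lambda>(x, y). g (x - y))"
proof (rule integrableI_bounded)
  have [measurable]: "g \<in> borel_measurable borel" using g by auto
  show "(\<lambda>(x, y). g (x - y)) \<in> borel_measurable (lborel \<Otimes>\<^sub>M P)" by measurable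
  have "(\<integral>\<^sup>+z. ennreal (norm (case z of (x, y) \<Rightarrow> g (x - y))) \<partial>(lborel \<Otimes>\<^sub>M P))
      = (\<integral>\<^sup>+y. (\<integral>\<^sup>+x. ennreal \<bar>g (x - y)\<bar> \<partial>lborel) \<partial>P)"
    by (subst nn_integral_snd[symmetric]) (auto simp: split_beta')
  also have "\<dots> = (\<integral>\<^sup>+x. ennreal \<bar>g x\<bar> \<partial>lborel)"
    by (simp add: nn_integral_lborel_translate[of "\<lambda>x. ennreal \<bar>g x\<bar>"] emeasure_space_1)
  also have "\<dots> < \<infinity>" using g by (simp add: integrable_iff_bounded)
  finally show "(\<integral>\<^sup>+z. ennreal (norm (case z of (x, y) \<Rightarrow> g (x - y))) \<partial>(lborel \<Otimes>\<^sub>M P)) < \<infinity>" .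
qed

lemma AE_integrable_translates:
  "integrable lborel g \<Longrightarrow> AE x in lborel. integrable P (\<lambda>y. g (x - y) :: real)"
  using AE_integrable_fst[OF integrable_translates] .

lemma integrable_mix: "integrable lborel g \<Longrightarrow> integrable lborel (mix g)"
  unfolding mix_def using integrable_fst[OF integrable_translates] .

lemma integral_mix:
  assumes g: "integrable lborel g"
  shows "(\<integral>x. mix g x \<partial>lborel) = (\<integral>x. g x \<partial>lborel)"
proof -
  have [measurable]: "g \<in> borel_measurable borel" using g by auto
  show ?thesis
    unfolding mix_def Fubini_integral[OF integrable_translates[OF g], symmetric]
    by (simp add: integral_lborel_translate prob_space)
qed

text \<open>
  Mixing is a contraction of \<open>L\<^sup>p\<close>: Jensen's inequality bounds \<open>\<bar>mix g x\<bar> powr p\<close> by the mixture of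
  \<open>\<bar>g\<bar> powr p\<close>, and mixing preserves integrals.
\<close>

lemma mix_Lp:
  fixes g :: "'a \<Rightarrow> real"
  assumes "1 \<le> p" and g: "integrable lborel g" and gp: "integrable lborel (\<lambda>x. \<bar>g x\<bar> powr p)"
  shows "integrable lborel (\<lambda>x. \<bar>mix g x\<bar> powr p)"
    and "(\<integral>x. \<bar>mix g x\<bar> powr p \<partial>lborel) \<le> (\<integral>x. \<bar>g x\<bar> powr p \<partial>lborel)"
proof -
  have [measurable]: "g \<in> borel_measurable borel" using g by auto
  have jensen: "AE x in lborel. \<bar>mix g x\<bar> powr p \<le> mix (\<lambda>x. \<bar>g x\<bar> powr p) x"
    using AE_integrable_translates[OF g] AE_integrable_translates[OF gp]
  proof eventually_elim
    case (elim x)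
    show ?case
      unfolding mix_def
      by (rule jensens_inequality[where I = UNIV, OF elim(1) _ _ elim(2) convex_on_abs_powr[OF \<open>1 \<le> p\<close>]]) auto
  qed
  show int: "integrable lborel (\<lambda>x. \<bar>mix g x\<bar> powr p)"
    by (rule Bochner_Integration.integrable_bound[OF integrable_mix[OF gp]])
       (use jensen in \<open>auto elim!: eventually_mono\<close>)
  show "(\<integral>x. \<bar>mix g x\<bar> powr p \<partial>lborel) \<le> (\<integral>x. \<bar>g x\<bar> powr p \<partial>lborel)"
    using integral_mono_AE[OF int integrable_mix[OF gp] jensen] by (simp add: integral_mix[OF gp])
qed

lemma mix_bounds:
  assumes [measurable]: "g \<in> borel_measurable borel" and b: "\<And>x. 0 \<le> g x" "\<And>x. g x \<le> K"
  shows "0 \<le> mix g x" "mix g x \<le> K"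
proof -
  have "integrable P (\<lambda>y. g (x - y))"
    by (rule integrable_const_bound[of _ K]) (use b in auto)
  then show "mix g x \<le> K" unfolding mix_def by (rule integral_le_const) (use b in auto)
  show "0 \<le> mix g x" unfolding mix_def using b by simp
qed

text \<open>
  By Fubini's theorem the right-hand side is the \<open>P\<close>-mean over \<open>y\<close> of the left-hand side, and
  some value of a function does not exceed its mean.
\<close>

lemma translate_below_mean:
  fixes g G :: "'a \<Rightarrow> real"
  assumes g: "integrable lborel g" and G [measurable]: "G \<in> borel_measurable borel"
    and b: "\<And>x. \<bar>G x\<bar> \<le> B"
  shows "\<exists>y. (\<integral>x. G x * g (x - y) \<partial>lborel) \<le> (\<integral>x. G x * mix g x \<partial>lborel)"
proof (rule ccontr)
  have [measurable]: "g \<in> borel_measurable borel" using g by auto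
  have "integrable (lborel \<Otimes>\<^sub>M P) (\<lambda>z. G (fst z) * (case z of (x, y) \<Rightarrow> g (x - y)))"
    by (rule integrable_mult_bounded[OF integrable_translates[OF g]]) (use b in auto)
  then have int: "integrable (lborel \<Otimes>\<^sub>M P) (\<lambda>(x, y). G x * g (x - y))"
    by (simp add: split_beta')
  assume "\<not> ?thesis"
  then have "(\<integral>x. G x * mix g x \<partial>lborel) < expectation (\<lambda>y. \<integral>x. G x * g (x - y) \<partial>lborel)"
    by (intro expectation_greater integrable_snd[OF int]) (auto simp: not_le)
  also have "\<dots> = (\<integral>x. G x * mix g x \<partial>lborel)"
    unfolding Fubini_integral[OF int] mix_def by simp
  finally show False by simp
qed

text \<open>
  This is the second-moment bound for the error of an empirical mean, with the independent sample
  replaced by a greedy choice. Write \<open>S = (\<Sum>i=1..m. g (x - y i)) - m * F\<close> with \<open>F = mix g\<close>.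
  A further centre \<open>z\<close> adds \<open>g (x - z) - F\<close> to \<open>S\<close>. With \<open>G = S - F\<close>, the new square integral is
  that of \<open>G\<^sup>2 + 2 * G * g (x - z) + g (x - z)\<^sup>2\<close>; if \<open>z\<close> is chosen such that the middle term is at
  most its mean, this is at most the integral of
  \<open>(G + F)\<^sup>2 - F\<^sup>2 + g\<^sup>2 \<le> S\<^sup>2 + g\<^sup>2\<close>. So each centre adds at most the square integral of \<open>g\<close>.
\<close>

lemma greedy_centres:
  fixes g :: "'a \<Rightarrow> real"
  assumes g: "integrable lborel g" and b: "\<And>x. 0 \<le> g x" "\<And>x. g x \<le> K"
  shows "\<exists>y :: nat \<Rightarrow> 'a. (\<integral>x. ((\<Sum>i=1..m. g (x - y i)) - m * mix g x)\<^sup>2 \<partial>lborel)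
            \<le> m * (\<integral>x. (g x)\<^sup>2 \<partial>lborel)"
proof (induction m)
  case 0
  then show ?case by simp
next
  case (Suc m)
  have [measurable]: "g \<in> borel_measurable borel" using g by auto
  from Suc obtain y where
    y: "(\<integral>x. ((\<Sum>i=1..m. g (x - y i)) - m * mix g x)\<^sup>2 \<partial>lborel) \<le> m * (\<integral>x. (g x)\<^sup>2 \<partial>lborel)"
    by blast
  define F where "F = mix g"
  define G where "G x = (\<Sum>i=1..m. g (x - y i)) - m * F x - F x" for x
  note fb = mix_bounds[OF \<open>g \<in> borel_measurable borel\<close> b, folded F_def]
  have [measurable]: "F \<in> borel_measurable borel" unfolding F_def by measurable
  have Gm [measurable]: "G \<in> borel_measurable borel" unfolding G_def by measurable
  have Fi: "integrable lborel F" unfolding F_def by (rule integrable_mix[OF g])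
  have Gi: "integrable lborel G"
    unfolding G_def using Fi g by (intro Bochner_Integration.integrable_diff Bochner_Integration.integrable_sum
      integrable_mult_right integrable_lborel_translate) auto
  have K: "0 \<le> K" using b[of 0] by linarith
  have Gb: "\<bar>G x\<bar> \<le> m * K + m * K + K" for x
  proof -
    have "0 \<le> (\<Sum>i=1..m. g (x - y i))" "(\<Sum>i=1..m. g (x - y i)) \<le> m * K"
      using sum_bounded_above[of "{1..m}" "\<lambda>i. g (x - y i)" K] b by (auto intro: sum_nonneg)
    moreover have "0 \<le> m * F x" "m * F x \<le> m * K" "0 \<le> F x" "F x \<le> K"
      using fb by (auto intro: mult_left_mono)
    ultimately show ?thesis unfolding G_def by linarith
  qed
  obtain z where z: "(\<integral>x. G x * g (x - z) \<partial>lborel) \<le> (\<integral>x. G x * F x \<partial>lborel)"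
    using translate_below_mean[OF g Gm Gb] unfolding F_def by blast
  have gz: "integrable lborel (\<lambda>x. g (x - z))" by (rule integrable_lborel_translate[OF g])
  have GG: "integrable lborel (\<lambda>x. (G x)\<^sup>2)"
    unfolding power2_eq_square by (rule integrable_mult_bounded[OF Gi _ Gb]) simp
  have Gg: "integrable lborel (\<lambda>x. G x * g (x - z))"
    by (rule integrable_mult_bounded[OF gz _ Gb]) simp
  have GF: "integrable lborel (\<lambda>x. G x * F x)"
    by (rule integrable_mult_bounded[OF Fi _ Gb]) simp
  have FF: "integrable lborel (\<lambda>x. (F x)\<^sup>2)"
    unfolding power2_eq_square by (rule integrable_mult_bounded[OF Fi, of _ K]) (use fb in auto)
  have gg: "integrable lborel (\<lambda>x. (g x)\<^sup>2)"
    unfolding power2_eq_square by (rule integrable_mult_bounded[OF g, of _ K]) (use b in auto)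
  have ggz: "integrable lborel (\<lambda>x. (g (x - z))\<^sup>2)"
    by (rule integrable_lborel_translate[OF gg])
  have "(\<integral>x. (G x + g (x - z))\<^sup>2 \<partial>lborel)
      = (\<integral>x. (G x)\<^sup>2 + (2 * (G x * g (x - z)) + (g (x - z))\<^sup>2) \<partial>lborel)"
    by (simp add: power2_eq_square algebra_simps)
  also have "\<dots> = (\<integral>x. (G x)\<^sup>2 \<partial>lborel) + (2 * (\<integral>x. G x * g (x - z) \<partial>lborel) + (\<integral>x. (g x)\<^sup>2 \<partial>lborel))"
    using GG Gg ggz by (simp add: integral_lborel_translate[of "\<lambda>x. (g x)\<^sup>2"])
  also have "\<dots> \<le> (\<integral>x. (G x)\<^sup>2 \<partial>lborel) + (2 * (\<integral>x. G x * F x \<partial>lborel) + (\<integral>x. (F x)\<^sup>2 \<partial>lborel))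
      + (\<integral>x. (g x)\<^sup>2 \<partial>lborel)"
    using z by (simp add: add_increasing2)
  also have "(\<integral>x. (G x)\<^sup>2 \<partial>lborel) + (2 * (\<integral>x. G x * F x \<partial>lborel) + (\<integral>x. (F x)\<^sup>2 \<partial>lborel))
      = (\<integral>x. (G x)\<^sup>2 + (2 * (G x * F x) + (F x)\<^sup>2) \<partial>lborel)"
    using GG GF FF by simp
  also have "\<dots> = (\<integral>x. ((\<Sum>i=1..m. g (x - y i)) - m * F x)\<^sup>2 \<partial>lborel)"
    by (simp add: G_def power2_eq_square algebra_simps)
  also have "\<dots> \<le> m * (\<integral>x. (g x)\<^sup>2 \<partial>lborel)" using y by (simp add: F_def)
  finally have *: "(\<integral>x. (G x + g (x - z))\<^sup>2 \<partial>lborel) \<le> Suc m * (\<integral>x. (g x)\<^sup>2 \<partial>lborel)"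
    by (simp add: algebra_simps)
  have eq: "(\<Sum>i=1..Suc m. g (x - (y(Suc m := z)) i)) - Suc m * mix g x = G x + g (x - z)" for x
  proof -
    have "(\<Sum>i=1..m. g (x - (y(Suc m := z)) i)) = (\<Sum>i=1..m. g (x - y i))"
      by (intro sum.cong) auto
    then show ?thesis by (simp add: G_def F_def algebra_simps)
  qed
  show ?case using * by (intro exI[of _ "y(Suc m := z)"]) (simp only: eq)
qed

lemma mix_diff:
  assumes "integrable lborel f" "integrable lborel g"
  shows "AE x in lborel. mix (\<lambda>x. f x - g x) x = mix f x - mix g x"
  using AE_integrable_translates[OF assms(1)] AE_integrable_translates[OF assms(2)]
  unfolding mix_def by eventually_elim simp

text \<open>
  The error \<open>h\<close> of the average over \<open>m\<close> greedily chosen centres is bounded by \<open>K\<close>, its \<open>L\<^sup>1\<close> norm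
  stays below a constant \<open>c\<close>, and the integral of its square is \<open>O(1 / m)\<close>. By interpolation
  its \<open>L\<^sup>p\<close> norm is small when first the threshold \<open>\<delta>\<close> is taken small and then \<open>m\<close> large.
\<close>

lemma bounded_kernel_averages:
  fixes g :: "'a \<Rightarrow> real"
  assumes "1 < p" and g: "integrable lborel g" and b: "\<And>x. 0 \<le> g x" "\<And>x. g x \<le> K" and "0 < \<epsilon>"
  shows "\<exists>m\<ge>1. \<exists>y :: nat \<Rightarrow> 'a.
    integrable lborel (\<lambda>x. \<bar>(\<Sum>i=1..m. g (x - y i)) / m - mix g x\<bar> powr p) \<and>
    (\<integral>x. \<bar>(\<Sum>i=1..m. g (x - y i)) / m - mix g x\<bar> powr p \<partial>lborel) < \<epsilon>"
proof -
  have gm [measurable]: "g \<in> borel_measurable borel" using g by auto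
  define c where "c = 2 * (\<integral>x. g x \<partial>lborel)"
  have "0 \<le> c" unfolding c_def using b by (simp add: integral_nonneg_AE)
  \<comment> \<open>solves \<open>\<delta> powr (p - 1) * (c + 1) = \<epsilon> / 2\<close>; the \<open>+ 1\<close> covers \<open>c = 0\<close>\<close>
  define \<delta> where "\<delta> = (\<epsilon> / (2 * (c + 1))) powr (1 / (p - 1))"
  have "0 < \<delta>" using \<open>0 < \<epsilon>\<close> \<open>0 \<le> c\<close> by (simp add: \<delta>_def)
  have "\<delta> powr (p - 1) = \<epsilon> / (2 * (c + 1))"
    using assms(1,5) \<open>0 \<le> c\<close> by (simp add: \<delta>_def powr_powr)
  then have \<delta>: "\<delta> powr (p - 1) * c < \<epsilon> / 2"
    using \<open>0 < \<epsilon>\<close> \<open>0 \<le> c\<close> by (simp add: divide_less_eq)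
  define D where "D = \<delta> powr (p - 2) + K powr (p - 2)"
  define V where "V = (\<integral>x. (g x)\<^sup>2 \<partial>lborel)"
  have "0 \<le> D" by (simp add: D_def)
  obtain m :: nat where m: "2 * D * V / \<epsilon> < m" "1 \<le> m"
    using reals_Archimedean2[of "max 1 (2 * D * V / \<epsilon>)"] by (metis less_eq_real_def max_less_iff_conj of_nat_1 of_nat_le_iff)
  have DV: "D * (V / m) < \<epsilon> / 2"
    using m \<open>0 < \<epsilon>\<close> by (simp add: field_simps)
  obtain y where
    y: "(\<integral>x. ((\<Sum>i=1..m. g (x - y i)) - m * mix g x)\<^sup>2 \<partial>lborel) \<le> m * V"
    using greedy_centres[OF g b] unfolding V_def by blast
  define A where "A x = (\<Sum>i=1..m. g (x - y i)) / m" for x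
  define h where "h x = A x - mix g x" for x
  have [measurable]: "A \<in> borel_measurable borel" "h \<in> borel_measurable borel"
    unfolding A_def h_def by measurable
  have Ai: "integrable lborel A"
    unfolding A_def using g by (intro integrable_divide Bochner_Integration.integrable_sum integrable_lborel_translate) auto
  have hi: "integrable lborel h"
    unfolding h_def by (rule Bochner_Integration.integrable_diff[OF Ai integrable_mix[OF g]])
  have A01: "0 \<le> A x" "A x \<le> K" for x
  proof -
    show "0 \<le> A x" unfolding A_def using b by (simp add: sum_nonneg)
    show "A x \<le> K" unfolding A_def
      using sum_bounded_above[of "{1..m}" "\<lambda>i. g (x - y i)" K] b m by (simp add: field_simps)
  qed
  note mb = mix_bounds[OF gm b]
  have hb: "\<bar>h x\<bar> \<le> K" for x
    unfolding h_def using A01[of x] mb[of x] by linarith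
  have "(\<integral>x. A x \<partial>lborel) = (\<integral>x. g x \<partial>lborel)"
    unfolding A_def using g m
    by (simp add: Bochner_Integration.integral_sum integrable_lborel_translate integral_lborel_translate)
  then have "(\<integral>x. A x + mix g x \<partial>lborel) = c"
    using Ai integrable_mix[OF g] integral_mix[OF g] by (simp add: c_def)
  moreover have "(\<integral>x. \<bar>h x\<bar> \<partial>lborel) \<le> (\<integral>x. A x + mix g x \<partial>lborel)"
    using Ai integrable_mix[OF g] hi A01 mb
    by (intro integral_mono) (auto simp: h_def abs_le_iff add_increasing add_increasing2)
  ultimately have h1: "(\<integral>x. \<bar>h x\<bar> \<partial>lborel) \<le> c" by simp
  have hh: "integrable lborel (\<lambda>x. (h x)\<^sup>2)"
    unfolding power2_eq_square by (rule integrable_mult_bounded[OF hi _ hb]) simp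
  have "(\<Sum>i=1..m. g (x - y i)) - m * mix g x = m * h x" for x
    using m by (simp add: h_def A_def field_simps)
  with y have "m\<^sup>2 * (\<integral>x. (h x)\<^sup>2 \<partial>lborel) \<le> m * V"
    by (simp add: power_mult_distrib)
  then have h2: "(\<integral>x. (h x)\<^sup>2 \<partial>lborel) \<le> V / m"
    using m by (simp add: field_simps power2_eq_square)
  have dom: "integrable lborel (\<lambda>x. \<delta> powr (p - 1) * \<bar>h x\<bar> + D * (h x)\<^sup>2)"
    using hi hh by simp
  have le: "\<bar>h x\<bar> powr p \<le> \<delta> powr (p - 1) * \<bar>h x\<bar> + D * (h x)\<^sup>2" for x
    unfolding D_def by (rule powr_interpolation[OF \<open>1 < p\<close> \<open>0 < \<delta>\<close> hb])
  have int: "integrable lborel (\<lambda>x. \<bar>h x\<bar> powr p)"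
    by (rule Bochner_Integration.integrable_bound[OF dom]) (use le in \<open>auto intro!: AE_I2 order_trans[OF le abs_ge_self]\<close>)
  have "(\<integral>x. \<bar>h x\<bar> powr p \<partial>lborel) \<le> (\<integral>x. \<delta> powr (p - 1) * \<bar>h x\<bar> + D * (h x)\<^sup>2 \<partial>lborel)"
    by (rule integral_mono[OF int dom le])
  also have "\<dots> = \<delta> powr (p - 1) * (\<integral>x. \<bar>h x\<bar> \<partial>lborel) + D * (\<integral>x. (h x)\<^sup>2 \<partial>lborel)"
    using hi hh by simp
  also have "\<dots> \<le> \<delta> powr (p - 1) * c + D * (V / m)"
    using h1 h2 \<open>0 \<le> D\<close> by (intro add_mono mult_left_mono) auto
  also have "\<dots> < \<epsilon>" using \<delta> DV by linarith
  finally show ?thesis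
    using int m by (intro exI[of _ m] conjI exI[of _ y]) (auto simp: h_def A_def)
qed

text \<open>
  Split the kernel as \<open>\<psi> = g + r\<close> with \<open>g = min \<psi> n\<close> bounded and \<open>r\<close> small in \<open>L\<^sup>p\<close>. Averaging
  translates and mixing both contract \<open>L\<^sup>p\<close>, so \<open>r\<close> contributes little to either side for every
  choice of centres, and the centres can be chosen for \<open>g\<close> alone.
\<close>

theorem averages_approximate_mixture:
  fixes \<psi> :: "'a \<Rightarrow> real"
  assumes "1 < p" and \<psi>: "integrable lborel \<psi>" and nonneg: "\<And>x. 0 \<le> \<psi> x"
    and \<psi>p: "integrable lborel (\<lambda>x. \<bar>\<psi> x\<bar> powr p)" and "0 < \<epsilon>"
  shows "\<exists>m\<ge>1. \<exists>y :: nat \<Rightarrow> 'a.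
    (\<integral>x. \<bar>(\<Sum>i=1..m. \<psi> (x - y i)) / m - mix \<psi> x\<bar> powr p \<partial>lborel) < \<epsilon>"
proof -
  have \<psi>m [measurable]: "\<psi> \<in> borel_measurable borel" using \<psi> by auto
  \<comment> \<open>the error has three parts, and splitting a \<open>p\<close>-th power into three costs a factor \<open>3 powr p\<close>\<close>
  define \<eta> where "\<eta> = \<epsilon> / (3 * 3 powr p)"
  have "0 < \<eta>" using \<open>0 < \<epsilon>\<close> by (simp add: \<eta>_def)
  have "eventually (\<lambda>n. (\<integral>x. \<bar>\<psi> x - min (\<psi> x) (real n)\<bar> powr p \<partial>lborel) < \<eta>) sequentially"
    using truncation_Lp_tendsto_zero[OF _ \<psi>m nonneg \<psi>p] \<open>1 < p\<close> \<open>0 < \<eta>\<close>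
    by (intro order_tendstoD(2)) auto
  then obtain n where n: "(\<integral>x. \<bar>\<psi> x - min (\<psi> x) (real n)\<bar> powr p \<partial>lborel) < \<eta>"
    by (auto simp: eventually_sequentially)
  define g where "g x = min (\<psi> x) (real n)" for x
  define r where "r x = \<psi> x - g x" for x
  have [measurable]: "g \<in> borel_measurable borel" "r \<in> borel_measurable borel"
    unfolding g_def r_def by measurable
  have gb: "0 \<le> g x" "g x \<le> real n" "g x \<le> \<psi> x" for x using nonneg by (auto simp: g_def)
  have g: "integrable lborel g"
    by (rule Bochner_Integration.integrable_bound[OF \<psi>]) (use gb nonneg in auto)
  have r: "integrable lborel r" unfolding r_def using \<psi> g by simp
  have rb: "\<bar>r x\<bar> \<le> \<bar>\<psi> x\<bar>" for x using gb[of x] by (simp add: r_def)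
  have rp: "integrable lborel (\<lambda>x. \<bar>r x\<bar> powr p)"
    by (rule Bochner_Integration.integrable_bound[OF \<psi>p])
       (use rb \<open>1 < p\<close> in \<open>auto intro!: AE_I2 powr_mono2\<close>)
  define R where "R = (\<integral>x. \<bar>r x\<bar> powr p \<partial>lborel)"
  have R: "R < \<eta>" using n by (simp add: R_def r_def g_def)
  obtain m :: nat and y :: "nat \<Rightarrow> 'a" where m: "1 \<le> m"
    and hp: "integrable lborel (\<lambda>x. \<bar>(\<Sum>i=1..m. g (x - y i)) / m - mix g x\<bar> powr p)"
    and h\<eta>: "(\<integral>x. \<bar>(\<Sum>i=1..m. g (x - y i)) / m - mix g x\<bar> powr p \<partial>lborel) < \<eta>"
    using bounded_kernel_averages[OF \<open>1 < p\<close> g gb(1,2) \<open>0 < \<eta>\<close>] by blast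
  define h where "h x = (\<Sum>i=1..m. g (x - y i)) / m - mix g x" for x
  define a where "a x = (\<Sum>i=1..m. r (x - y i)) / m" for x
  have [measurable]: "h \<in> borel_measurable borel" "a \<in> borel_measurable borel"
    unfolding h_def a_def by measurable
  have rpy: "integrable lborel (\<lambda>x. \<bar>r (x - z)\<bar> powr p)" for z
    using integrable_lborel_translate[OF rp] .
  have le_a: "\<bar>a x\<bar> powr p \<le> (\<Sum>i=1..m. \<bar>r (x - y i)\<bar> powr p) / m" for x
    unfolding a_def using abs_average_powr_le[of p "{1..m}" "\<lambda>i. r (x - y i)"] \<open>1 < p\<close> m by simp
  have dom_a: "integrable lborel (\<lambda>x. (\<Sum>i=1..m. \<bar>r (x - y i)\<bar> powr p) / m)"
    using rpy by (intro integrable_divide Bochner_Integration.integrable_sum) auto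
  have ap: "integrable lborel (\<lambda>x. \<bar>a x\<bar> powr p)"
    by (rule Bochner_Integration.integrable_bound[OF dom_a])
       (use le_a in \<open>auto simp: abs_of_nonneg sum_nonneg\<close>)
  have "(\<integral>x. \<bar>a x\<bar> powr p \<partial>lborel) \<le> (\<integral>x. (\<Sum>i=1..m. \<bar>r (x - y i)\<bar> powr p) / m \<partial>lborel)"
    by (rule integral_mono[OF ap dom_a le_a])
  also have "\<dots> = R"
    using m rpy by (simp add: Bochner_Integration.integral_sum R_def
        integral_lborel_translate[of "\<lambda>x. \<bar>r x\<bar> powr p"])
  finally have aR: "(\<integral>x. \<bar>a x\<bar> powr p \<partial>lborel) \<le> R" .
  have mp: "integrable lborel (\<lambda>x. \<bar>mix r x\<bar> powr p)" and mR: "(\<integral>x. \<bar>mix r x\<bar> powr p \<partial>lborel) \<le> R"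
    using mix_Lp[OF _ r rp] \<open>1 < p\<close> by (auto simp: R_def)
  have split: "AE x in lborel. (\<Sum>i=1..m. \<psi> (x - y i)) / m - mix \<psi> x = a x + h x + - mix r x"
    using mix_diff[OF \<psi> g]
  proof eventually_elim
    case (elim x)
    then have "mix r x = mix \<psi> x - mix g x" by (simp add: r_def[abs_def])
    moreover have "(\<Sum>i=1..m. \<psi> (x - y i)) = (\<Sum>i=1..m. r (x - y i)) + (\<Sum>i=1..m. g (x - y i))"
      by (simp add: r_def sum_subtractf)
    ultimately show ?case by (simp add: a_def h_def add_divide_distrib)
  qed
  have hp': "integrable lborel (\<lambda>x. \<bar>h x\<bar> powr p)" using hp by (simp add: h_def)
  have le: "\<bar>a x + h x + - mix r x\<bar> powr p \<le> 3 powr p * (\<bar>a x\<bar> powr p + \<bar>h x\<bar> powr p + \<bar>mix r x\<bar> powr p)" for x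
    using abs_sum3_powr_le[of p "a x" "h x" "- mix r x"] \<open>1 < p\<close> by simp
  have dom: "integrable lborel (\<lambda>x. 3 powr p * (\<bar>a x\<bar> powr p + \<bar>h x\<bar> powr p + \<bar>mix r x\<bar> powr p))"
    using ap hp' mp by simp
  have "(\<integral>x. \<bar>(\<Sum>i=1..m. \<psi> (x - y i)) / m - mix \<psi> x\<bar> powr p \<partial>lborel)
      = (\<integral>x. \<bar>a x + h x + - mix r x\<bar> powr p \<partial>lborel)"
    by (rule integral_cong_AE) (use split in \<open>auto elim!: eventually_mono\<close>)
  also have "\<dots> \<le> (\<integral>x. 3 powr p * (\<bar>a x\<bar> powr p + \<bar>h x\<bar> powr p + \<bar>mix r x\<bar> powr p) \<partial>lborel)"
    by (rule integral_mono'[OF dom le]) simp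
  also have "\<dots> = 3 powr p * ((\<integral>x. \<bar>a x\<bar> powr p \<partial>lborel) + (\<integral>x. \<bar>h x\<bar> powr p \<partial>lborel) + (\<integral>x. \<bar>mix r x\<bar> powr p \<partial>lborel))"
    using ap hp' mp by simp
  also have "\<dots> < 3 powr p * (\<eta> + \<eta> + \<eta>)"
    using aR h\<eta> mR R by (intro mult_strict_left_mono) (auto simp: h_def)
  also have "\<dots> = \<epsilon>" by (simp add: \<eta>_def)
  finally show ?thesis using m by blast
qed

end

section \<open>Borel representatives and Lp spaces\<close>

text \<open>
  If \<open>g\<close> is only Lebesgue measurable, then \<open>\<lambda>(x, y). g (x - y)\<close> need not be measurable for a
  product \<open>\<sigma>\<close>-algebra, so Fubini's theorem is applied to Borel representatives. Neither \<open>Lp\<close>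
  membership nor the norm depends on the representative.
\<close>

lemma borel_representative_nonneg:
  fixes f :: "'a::euclidean_space \<Rightarrow> real"
  assumes f: "f \<in> borel_measurable lebesgue" and nonneg: "\<And>x. 0 \<le> f x"
  obtains f' where "f' \<in> borel_measurable borel" "\<And>x. 0 \<le> f' x" "AE x in lborel. f x = f' x"
proof -
  obtain g where g: "g \<in> borel_measurable lborel" "AE x in lborel. f x = g x"
    using completion_ex_borel_measurable_real[OF f] by blast
  have "AE x in lborel. f x = max 0 (g x)"
    using g(2) by eventually_elim (metis max.absorb2 nonneg)
  then show thesis using g(1) by (intro that[of "\<lambda>x. max 0 (g x)"]) auto
qed

lemma lebesgue_measurable_representative:
  fixes f f' :: "'a::euclidean_space \<Rightarrow> real"
  assumes "f' \<in> borel_measurable borel" and "AE x in lborel. f x = f' x"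
  shows "f \<in> borel_measurable lebesgue"
proof (rule borel_measurable_AE[of f'])
  show "f' \<in> borel_measurable lebesgue"
    using assms(1) by (intro measurable_completion) simp
  show "AE x in lebesgue. f' x = f x"
    using assms(2) by (intro AE_completion) (auto elim!: eventually_mono)
qed

lemma integral_lebesgue_representative:
  fixes f f' :: "'a::euclidean_space \<Rightarrow> real"
  assumes f': "f' \<in> borel_measurable borel" and eq: "AE x in lborel. f x = f' x"
  shows "(\<integral>x. f x \<partial>lebesgue) = (\<integral>x. f' x \<partial>lborel)"
    and "integrable lebesgue f \<longleftrightarrow> integrable lborel f'"
proof -
  note m = lebesgue_measurable_representative[OF f' eq] lebesgue_measurable_representative[OF f' AE_I2, OF refl]
  have eq': "AE x in lebesgue. f x = f' x" using eq by (rule AE_completion)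
  have f'': "f' \<in> borel_measurable lborel" using f' by simp
  show "(\<integral>x. f x \<partial>lebesgue) = (\<integral>x. f' x \<partial>lborel)"
    using integral_cong_AE[OF m eq'] integral_completion[OF f''] by simp
  show "integrable lebesgue f \<longleftrightarrow> integrable lborel f'"
    using integrable_cong_AE[OF m eq'] integrable_completion[OF f''] by simp
qed

lemma Lp_representative:
  fixes f f' :: "real ^ 'd \<Rightarrow> real"
  assumes f': "f' \<in> borel_measurable borel" and eq: "AE x in lborel. f x = f' x"
  shows "f \<in> Lp p \<longleftrightarrow> integrable lborel (\<lambda>x. \<bar>f' x\<bar> powr p)"
    and "Lp_norm p f = (\<integral>x. \<bar>f' x\<bar> powr p \<partial>lborel) powr (1 / p)"
proof -
  have m: "(\<lambda>x. \<bar>f' x\<bar> powr p) \<in> borel_measurable borel" using f' by measurable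
  have eq': "AE x in lborel. \<bar>f x\<bar> powr p = \<bar>f' x\<bar> powr p"
    using eq by eventually_elim simp
  note I = integral_lebesgue_representative[OF m eq']
  show "f \<in> Lp p \<longleftrightarrow> integrable lborel (\<lambda>x. \<bar>f' x\<bar> powr p)"
    unfolding Lp_def using I(2) lebesgue_measurable_representative[OF f' eq] by simp
  show "Lp_norm p f = (\<integral>x. \<bar>f' x\<bar> powr p \<partial>lborel) powr (1 / p)"
    unfolding Lp_norm_def I(1) ..
qed

lemma Lp_diff:
  fixes f g :: "real ^ 'd \<Rightarrow> real"
  assumes "1 \<le> p" "f \<in> Lp p" "g \<in> Lp p"
  shows "(\<lambda>x. f x - g x) \<in> Lp p"
proof -
  have [measurable]: "f \<in> borel_measurable lebesgue" "g \<in> borel_measurable lebesgue"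
    using assms by (auto simp: Lp_def)
  have "integrable lebesgue (\<lambda>x. 2 powr (p - 1) * (\<bar>f x\<bar> powr p + \<bar>g x\<bar> powr p))"
    using assms by (auto simp: Lp_def)
  then have "integrable lebesgue (\<lambda>x. \<bar>f x - g x\<bar> powr p)"
    by (rule Bochner_Integration.integrable_bound)
       (use abs_diff_powr_le[OF \<open>1 \<le> p\<close>] in \<open>auto\<close>)
  then show ?thesis by (simp add: Lp_def)
qed

text \<open>
  The triangle inequality for two functions of norm at most \<open>N\<close> follows already from convexity:
  the factor \<open>2 powr (p - 1)\<close> and the two summands \<open>N powr p\<close> combine to \<open>(2 * N) powr p\<close>.
\<close>

lemma Lp_norm_diff_le:
  fixes f g :: "real ^ 'd \<Rightarrow> real"
  assumes "1 \<le> p" "f \<in> Lp p" "g \<in> Lp p" "Lp_norm p f \<le> N" "Lp_norm p g \<le> N"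
  shows "Lp_norm p (\<lambda>x. f x - g x) \<le> 2 * N"
proof -
  have "0 \<le> N" using assms(4) by (rule order_trans[rotated]) (simp add: Lp_norm_def)
  have le: "(\<integral>x. \<bar>h x\<bar> powr p \<partial>lebesgue) \<le> N powr p" if "Lp_norm p h \<le> N" for h :: "real ^ 'd \<Rightarrow> real"
  proof -
    have "(\<integral>x. \<bar>h x\<bar> powr p \<partial>lebesgue) = Lp_norm p h powr p"
      using \<open>1 \<le> p\<close> by (simp add: Lp_norm_def powr_powr)
    also have "\<dots> \<le> N powr p"
      using that \<open>1 \<le> p\<close> by (intro powr_mono2) (auto simp: Lp_norm_def)
    finally show ?thesis .
  qed
  have int: "integrable lebesgue (\<lambda>x. 2 powr (p - 1) * (\<bar>f x\<bar> powr p + \<bar>g x\<bar> powr p))"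
    using assms by (auto simp: Lp_def)
  have "(\<integral>x. \<bar>f x - g x\<bar> powr p \<partial>lebesgue) \<le> (\<integral>x. 2 powr (p - 1) * (\<bar>f x\<bar> powr p + \<bar>g x\<bar> powr p) \<partial>lebesgue)"
    by (rule integral_mono'[OF int]) (use abs_diff_powr_le[OF \<open>1 \<le> p\<close>] in auto)
  also have "\<dots> = 2 powr (p - 1) * ((\<integral>x. \<bar>f x\<bar> powr p \<partial>lebesgue) + (\<integral>x. \<bar>g x\<bar> powr p \<partial>lebesgue))"
    using assms by (auto simp: Lp_def)
  also have "\<dots> \<le> 2 powr (p - 1) * (N powr p + N powr p)"
    using le assms by (intro mult_left_mono add_mono) auto
  also have "\<dots> = (2 * N) powr p"
    using \<open>0 \<le> N\<close> by (simp add: powr_mult powr_diff)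
  finally have "Lp_norm p (\<lambda>x. f x - g x) \<le> ((2 * N) powr p) powr (1 / p)"
    unfolding Lp_norm_def using \<open>1 \<le> p\<close> by (intro powr_mono2) (auto intro: integral_nonneg_AE)
  also have "\<dots> = 2 * N" using \<open>1 \<le> p\<close> \<open>0 \<le> N\<close> by (simp add: powr_powr)
  finally show ?thesis .
qed

lemma Lp_norm_dilate:
  fixes \<phi> :: "real ^ 'd \<Rightarrow> real"
  assumes "1 < p" and "q = p / (p - 1)" and "0 < \<nu>" and \<phi>: "\<phi> \<in> borel_measurable borel"
  shows "(\<integral>x. \<bar>dilate \<phi> \<nu> x\<bar> powr p \<partial>lborel) powr (1 / p)
    = \<nu> powr (CARD('d) / q) * (\<integral>x. \<bar>\<phi> x\<bar> powr p \<partial>lborel) powr (1 / p)"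
proof -
  let ?d = "real CARD('d)" and ?J = "\<integral>x. \<bar>\<phi> (\<nu> *\<^sub>R x)\<bar> powr p \<partial>lborel"
  have I: "(\<integral>x. \<bar>\<phi> x\<bar> powr p \<partial>lborel) = \<nu> powr ?d * ?J"
    using integral_lborel_affine[of "\<lambda>x. \<bar>\<phi> x\<bar> powr p" \<nu> 0] \<phi> \<open>0 < \<nu>\<close>
    by (simp add: powr_realpow)
  have "\<bar>dilate \<phi> \<nu> x\<bar> powr p = \<nu> powr (?d * p) * \<bar>\<phi> (\<nu> *\<^sub>R x)\<bar> powr p" for x
  proof -
    have "\<nu> ^ CARD('d) = \<nu> powr ?d" using \<open>0 < \<nu>\<close> by (simp add: powr_realpow)
    then show ?thesis by (simp add: dilate_def abs_mult powr_mult powr_powr)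
  qed
  then have "(\<integral>x. \<bar>dilate \<phi> \<nu> x\<bar> powr p \<partial>lborel) = \<nu> powr (?d * p) * ?J" by simp
  also have "?d * p = ?d * (p - 1) + ?d" by (simp add: algebra_simps)
  also have "\<nu> powr (?d * (p - 1) + ?d) * ?J = \<nu> powr (?d * (p - 1)) * (\<integral>x. \<bar>\<phi> x\<bar> powr p \<partial>lborel)"
    unfolding I by (simp add: powr_add)
  finally show ?thesis
    using \<open>0 < \<nu>\<close> assms(1,2) by (simp add: powr_mult powr_powr integral_nonneg_AE)
qed

lemma Lp_norm_density_pos:
  assumes "\<phi> \<in> Lp p" "\<phi> \<in> densities"
  shows "0 < Lp_norm p \<phi>"
proof (rule ccontr)
  assume "\<not> ?thesis"
  then have "(\<integral>x. \<bar>\<phi> x\<bar> powr p \<partial>lebesgue) = 0"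
    by (simp add: Lp_norm_def not_less)
  then have "AE x in lebesgue. \<bar>\<phi> x\<bar> powr p = 0"
    using assms(1) by (subst (asm) integral_nonneg_eq_0_iff_AE) (auto simp: Lp_def)
  then have "(\<integral>x. \<phi> x \<partial>lebesgue) = 0"
    by (intro integral_eq_zero_AE) (auto elim!: eventually_mono)
  then show False using assms(2) by (simp add: densities_def)
qed

section \<open>Convolutions are limits of convex combinations of translates\<close>

lemma location_mixture_density:
  fixes f :: "'a::euclidean_space \<Rightarrow> real"
  assumes f: "integrable lborel f" and nonneg: "\<And>x. 0 \<le> f x" and one: "(\<integral>x. f x \<partial>lborel) = 1"
  shows "location_mixture (density lborel f)"
proof (intro location_mixture.intro location_mixture_axioms.intro prob_spaceI)
  have [measurable]: "f \<in> borel_measurable borel" using f by auto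
  show "emeasure (density lborel f) (space (density lborel f)) = 1"
    using nn_integral_eq_integral[OF f] nonneg one by (simp add: emeasure_density)
qed simp

text \<open>
  The equality holds at every point, not just almost everywhere: for fixed \<open>x\<close> the integrands
  differ on a null set of \<open>y\<close> only, and if they are not integrable then both sides are \<open>0\<close>.
\<close>

lemma convolve_eq_mix:
  fixes f f' g g' :: "real ^ 'd \<Rightarrow> real"
  assumes P: "location_mixture (density lborel g')"
    and f' [measurable]: "f' \<in> borel_measurable borel" and f: "AE x in lborel. f x = f' x"
    and g' [measurable]: "g' \<in> borel_measurable borel" and g: "AE x in lborel. g x = g' x"
    and nonneg: "\<And>x. 0 \<le> g' x"
  shows "convolve f g = location_mixture.mix (density lborel g') f'"
proof
  fix x
  have "AE y in lborel. g (x - y) = g' (x - y)"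
    using AE_lborel_affine[OF g, of "-1" x] by simp
  with f have "AE y in lborel. f y * g (x - y) = f' y * g' (x - y)"
    by eventually_elim simp
  then have "convolve f g x = (\<integral>y. f' y * g' (x - y) \<partial>lborel)"
    unfolding convolve_def by (intro integral_lebesgue_representative) measurable
  also have "\<dots> = (\<integral>y. f' (x - y) * g' y \<partial>lborel)"
    using integral_lborel_affine[of "\<lambda>y. f' y * g' (x - y)" "-1" x] by simp
  also have "\<dots> = location_mixture.mix (density lborel g') f' x"
    unfolding location_mixture.mix_def[OF P] using nonneg by (simp add: integral_density mult.commute)
  finally show "convolve f g x = location_mixture.mix (density lborel g') f' x" .
qed

lemma Lp_scale:
  assumes "f \<in> Lp p"
  shows "(\<lambda>x. c * f x) \<in> Lp p"
  using assms by (auto simp: Lp_def abs_mult powr_mult)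

lemma co_m_subset_Lp:
  assumes "1 \<le> p" and A: "A \<subseteq> Lp p"
  shows "co_m m A \<subseteq> Lp p"
proof -
  have "(\<lambda>x. \<Sum>j=1..k. w j * h j x) \<in> Lp p" if "\<forall>j\<in>{1..k}. h j \<in> A" for w h and k :: nat
    using that
  proof (induction k)
    case 0
    then show ?case by (simp add: Lp_def)
  next
    case (Suc k)
    then have "(\<lambda>x. (\<Sum>j=1..k. w j * h j x) - (- w (Suc k)) * h (Suc k) x) \<in> Lp p"
      using A by (intro Lp_diff[OF \<open>1 \<le> p\<close>] Lp_scale) auto
    then show ?case by simp
  qed
  then show ?thesis unfolding co_m_def by blast
qed

lemma average_in_co_m:
  assumes "1 \<le> m" and "\<And>j. h j \<in> A"
  shows "(\<lambda>x. (\<Sum>j=1..m. h j x) / m) \<in> co_m m A"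
  unfolding co_m_def
  by (rule CollectI, rule exI[of _ "\<lambda>_. 1 / m"], rule exI[of _ h])
     (use assms in \<open>auto simp: sum_divide_distrib\<close>)

text \<open>
  The averages of translates that approximate a mixture are convex combinations with equal
  weights. The kernel \<open>\<phi>\<close> is only Lebesgue measurable; \<open>\<psi>\<close> is its Borel representative.
\<close>

lemma mixture_in_Lp_closure_co:
  fixes \<phi> \<psi> :: "real ^ 'd \<Rightarrow> real" and P :: "(real ^ 'd) measure"
  assumes P: "location_mixture P" and "1 < p"
    and \<psi>: "integrable lborel \<psi>" and nonneg: "\<And>x. 0 \<le> \<psi> x"
    and \<psi>p: "integrable lborel (\<lambda>x. \<bar>\<psi> x\<bar> powr p)"
    and eq: "AE x in lborel. \<phi> x = \<psi> x"
  shows "location_mixture.mix P \<psi> \<in> Lp_closure p (co {\<lambda>x. \<phi> (x - \<mu>) | \<mu>. True})"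
proof -
  interpret location_mixture P by (rule P)
  have \<psi>m [measurable]: "\<psi> \<in> borel_measurable borel" using \<psi> by auto
  have "\<exists>g\<in>co {\<lambda>x. \<phi> (x - \<mu>) | \<mu>. True}. Lp_norm p (\<lambda>x. g x - mix \<psi> x) < \<delta>"
    if "0 < \<delta>" for \<delta>
  proof -
    obtain m :: nat and y :: "nat \<Rightarrow> real ^ 'd" where m: "1 \<le> m" and
      y: "(\<integral>x. \<bar>(\<Sum>i=1..m. \<psi> (x - y i)) / m - mix \<psi> x\<bar> powr p \<partial>lborel) < \<delta> powr p"
      using averages_approximate_mixture[OF \<open>1 < p\<close> \<psi> nonneg \<psi>p, of "\<delta> powr p"] \<open>0 < \<delta>\<close> by auto
    let ?g = "\<lambda>x. (\<Sum>i=1..m. \<phi> (x - y i)) / m"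
    have "AE x in lborel. \<forall>i\<in>{1..m}. \<phi> (x - y i) = \<psi> (x - y i)"
      using AE_lborel_affine[OF eq, of 1 "- y _"] by (intro AE_finite_allI) auto
    then have "AE x in lborel. ?g x - mix \<psi> x = (\<Sum>i=1..m. \<psi> (x - y i)) / m - mix \<psi> x"
      by eventually_elim simp
    then have "Lp_norm p (\<lambda>x. ?g x - mix \<psi> x)
        = (\<integral>x. \<bar>(\<Sum>i=1..m. \<psi> (x - y i)) / m - mix \<psi> x\<bar> powr p \<partial>lborel) powr (1 / p)"
      by (intro Lp_representative(2)) measurable
    also have "\<dots> < (\<delta> powr p) powr (1 / p)"
      using y \<open>1 < p\<close> by (intro powr_less_mono2) (auto intro: integral_nonneg_AE)
    also have "\<dots> = \<delta>" using \<open>0 < \<delta>\<close> \<open>1 < p\<close> by (simp add: powr_powr)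
    finally have "Lp_norm p (\<lambda>x. ?g x - mix \<psi> x) < \<delta>" .
    moreover have "?g \<in> co_m m {\<lambda>x. \<phi> (x - \<mu>) | \<mu>. True}"
      by (rule average_in_co_m[OF m, of "\<lambda>i x. \<phi> (x - y i)"]) blast
    then have "?g \<in> co {\<lambda>x. \<phi> (x - \<mu>) | \<mu>. True}"
      unfolding co_def by (rule UN_I[OF UNIV_I])
    ultimately show ?thesis by (rule bexI)
  qed
  moreover have "mix \<psi> \<in> Lp p"
    using Lp_representative(1)[of "mix \<psi>" "mix \<psi>" p] mix_Lp(1)[OF _ \<psi> \<psi>p] \<open>1 < p\<close> by simp
  ultimately show ?thesis unfolding Lp_closure_def by blast
qed

theorem lemma1:
  fixes p q C \<nu> :: real
    and \<phi> f0 :: "real ^ 'd \<Rightarrow> real"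
  assumes "1 < p" and "q = p / (p - 1)"
    and "convex_approx_constant TYPE('d) p C"
    and "\<phi> \<in> Lp p \<inter> densities" and "f0 \<in> Lp p \<inter> densities"
    and "\<nu> > 0"
  shows "\<exists>f :: nat \<Rightarrow> real ^ 'd \<Rightarrow> real. \<forall>m\<ge>1.
    f m \<in> co_m m (location_family \<phi> \<nu>) \<and>
    (\<lambda>x. f m x - convolve (dilate \<phi> \<nu>) f0 x) \<in> Lp p \<and>
    Lp_norm p (\<lambda>x. f m x - convolve (dilate \<phi> \<nu>) f0 x) \<le>
      (if p < 2
       then 3 * \<nu> powr (real CARD('d) / q) * Lp_norm p \<phi> * C * real m powr (- 1 / q)
       else 3 * \<nu> powr (real CARD('d) / q) * Lp_norm p \<phi> * C * real m powr (- 1 / 2))"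
proof -
  have p: "1 \<le> p" using \<open>1 < p\<close> by simp
  obtain \<phi>' where \<phi>'m [measurable]: "\<phi>' \<in> borel_measurable borel" and \<phi>'0: "\<And>x. 0 \<le> \<phi>' x"
    and \<phi>': "AE x in lborel. \<phi> x = \<phi>' x"
    using borel_representative_nonneg[of \<phi>] assms(4) by (auto simp: densities_def)
  obtain g where gm [measurable]: "g \<in> borel_measurable borel" and g0: "\<And>x. 0 \<le> g x"
    and g: "AE x in lborel. f0 x = g x"
    using borel_representative_nonneg[of f0] assms(5) by (auto simp: densities_def)
  have gi: "integrable lborel g" "(\<integral>x. g x \<partial>lborel) = 1"
    using integral_lebesgue_representative[OF gm g] assms(5) by (auto simp: densities_def)
  have P: "location_mixture (density lborel g)"
    by (rule location_mixture_density[OF gi(1) g0 gi(2)])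
  interpret location_mixture "density lborel g" by (rule P)
  define \<psi> where "\<psi> = dilate \<phi>' \<nu>"
  have \<psi>m [measurable]: "\<psi> \<in> borel_measurable borel"
    unfolding \<psi>_def dilate_def[abs_def] by measurable
  have \<psi>0: "0 \<le> \<psi> x" for x using \<phi>'0 \<open>\<nu> > 0\<close> by (simp add: \<psi>_def dilate_def)
  have eq: "AE x in lborel. dilate \<phi> \<nu> x = \<psi> x"
    using AE_lborel_affine[OF \<phi>', of \<nu> 0] \<open>\<nu> > 0\<close>
    by (auto simp: \<psi>_def dilate_def elim!: eventually_mono)
  have "integrable lborel \<phi>'"
    using integral_lebesgue_representative(2)[OF \<phi>'m \<phi>'] assms(4) by (auto simp: densities_def)
  from integrable_lborel_affine[OF this, of \<nu> 0] \<open>\<nu> > 0\<close> have \<psi>i: "integrable lborel \<psi>"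
    by (simp add: \<psi>_def dilate_def[abs_def])
  have "integrable lborel (\<lambda>x. \<bar>\<phi>' x\<bar> powr p)"
    using Lp_representative(1)[OF \<phi>'m \<phi>'] assms(4) by auto
  from integrable_lborel_affine[OF this, of \<nu> 0] \<open>\<nu> > 0\<close>
  have \<psi>p: "integrable lborel (\<lambda>x. \<bar>\<psi> x\<bar> powr p)"
    by (simp add: \<psi>_def dilate_def[abs_def] abs_mult powr_mult)

  define N where "N = \<nu> powr (CARD('d) / q) * Lp_norm p \<phi>"
  have "0 < N" using Lp_norm_density_pos[of \<phi> p] assms(4,6) by (simp add: N_def)
  have N: "(\<integral>x. \<bar>\<psi> x\<bar> powr p \<partial>lborel) powr (1 / p) = N"
    unfolding N_def \<psi>_def Lp_representative(2)[OF \<phi>'m \<phi>']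
    by (rule Lp_norm_dilate[OF assms(1,2,6) \<phi>'m])

  define A where "A = location_family \<phi> \<nu>"
  have A: "A = {\<lambda>x. dilate \<phi> \<nu> (x - \<mu>) | \<mu>. True}" by (simp add: A_def location_family_def)
  have A_Lp: "h \<in> Lp p \<and> Lp_norm p h = N" if hA: "h \<in> A" for h
  proof -
    obtain \<mu> where h: "h = (\<lambda>x. dilate \<phi> \<nu> (x - \<mu>))" using hA unfolding A by blast
    have m: "(\<lambda>x. \<psi> (x - \<mu>)) \<in> borel_measurable borel" by measurable
    have "AE x in lborel. h x = \<psi> (x - \<mu>)"
      using AE_lborel_affine[OF eq, of 1 "- \<mu>"] by (simp add: h)
    note R = Lp_representative[OF m this]
    show ?thesis
      using R integrable_lborel_translate[OF \<psi>p] N integral_lborel_translate[of "\<lambda>x. \<bar>\<psi> x\<bar> powr p" \<mu>]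
      by simp
  qed
  define F where "F = convolve (dilate \<phi> \<nu>) f0"
  have F: "F = mix \<psi>"
    unfolding F_def by (rule convolve_eq_mix[OF P \<psi>m eq gm g g0])
  have Fm: "mix \<psi> \<in> borel_measurable borel" by measurable
  note FR = Lp_representative[OF Fm AE_I2, OF refl]
  have F_Lp: "F \<in> Lp p" unfolding F using FR(1) mix_Lp(1)[OF p \<psi>i \<psi>p] by simp
  have F_norm: "Lp_norm p F \<le> N"
    unfolding F FR(2) N[symmetric] using mix_Lp(2)[OF p \<psi>i \<psi>p] p
    by (intro powr_mono2) (auto intro: integral_nonneg_AE)
  have F_cl: "F \<in> Lp_closure p (co A)"
    unfolding F A by (rule mixture_in_Lp_closure_co[OF P \<open>1 < p\<close> \<psi>i \<psi>0 \<psi>p eq])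
  have dist: "\<forall>h\<in>A. Lp_norm p (\<lambda>x. h x - F x) \<le> 2 * N"
    using Lp_norm_diff_le[OF p _ F_Lp _ F_norm] A_Lp by simp
  have "A \<subseteq> Lp p" using A_Lp by blast
  \<comment> \<open>radius \<open>B = 2 * N\<close> and slack \<open>\<epsilon> = N\<close> add up to the factor \<open>3\<close> of the bound\<close>
  have "\<exists>f :: nat \<Rightarrow> real ^ 'd \<Rightarrow> real. \<forall>m\<ge>1. f m \<in> co_m m A \<and>
           Lp_norm p (\<lambda>x. f m x - F x) \<le>
             (if p < 2 then (2 * N + N) * C * real m powr (- 1 / (p / (p - 1)))
              else (2 * N + N) * C * real m powr (- 1 / 2))"
    using assms(3)[unfolded convex_approx_constant_def, rule_format, of A F "2 * N" N]
      \<open>A \<subseteq> Lp p\<close> F_cl dist \<open>0 < N\<close> by simp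
  then obtain f :: "nat \<Rightarrow> real ^ 'd \<Rightarrow> real" where f: "\<And>m. 1 \<le> m \<Longrightarrow> f m \<in> co_m m A"
    "\<And>m. 1 \<le> m \<Longrightarrow> Lp_norm p (\<lambda>x. f m x - F x) \<le>
             (if p < 2 then (2 * N + N) * C * real m powr (- 1 / q)
              else (2 * N + N) * C * real m powr (- 1 / 2))"
    unfolding assms(2) by blast
  have diff_Lp: "(\<lambda>x. f m x - F x) \<in> Lp p" if "1 \<le> m" for m
    using f(1)[OF that] co_m_subset_Lp[OF p \<open>A \<subseteq> Lp p\<close>] by (intro Lp_diff[OF p _ F_Lp]) blast
  have const: "2 * N + N = 3 * \<nu> powr (CARD('d) / q) * Lp_norm p \<phi>" by (simp add: N_def)
  show ?thesis
    using f[unfolded F_def A_def const] diff_Lp[unfolded F_def] by blast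
qed

end
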